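(* Let $G=(V,E)$ be a finite connected graph with $|V|=n$. For $I\subseteq V$ let $a(I)=|V\setminus N[I]|=n-|I|-|N(I)|$, and for each independent set $I$ of $G$ define $b(I)$ recursively by $$b(\varnothing)=1,\qquad b(I)=\frac{1}{n-a(I)}\sum_{v\in I} b(I\setminus\{v\})\quad (I\neq\varnothing).$$ Then the number $\sigma(G)$ of successive vertex orderings of $G$ is $$\sigma(G)=n!\sum_{\substack{I\subseteq V\\ I\ \text{independent}}}(-1)^{|I|}\,\frac{a(I)}{n}\,b(I).$$
   Context: A linear ordering of $V$ is a bijection $\pi:V\to\{1,\dots,n\}$. It is successive if every vertex $v$ with $\pi(v)>1$ has a neighbour $u$ with $\pi(u)<\pi(v)$; $\sigma(G)$ is the number of successive linear orderings. For $I\subseteq V$, $N(I)$ is the set of vertices adjacent to at least one vertex of $I$ (open neighbourhood) and $N[I]=I\cup N(I)$ (closed neighbourhood). A set is independent if no two of its vertices are adjacent; the empty set is independent. *)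

theory Defs
  imports Complex_Main "HOL-Library.FuncSet" "Graph_Theory.Digraph_Component"
begin

text \<open>
  Finite simple graphs are the locale \<^term>\<open>graph\<close> of the library: finite symmetric digraphs
  without loops and parallel arcs. In such a graph \<open>u \<rightarrow>\<^bsub>G\<^esub> v\<close> means that \<open>u\<close> and \<open>v\<close> are adjacent.
\<close>

text \<open>Orderings are extensional functions, so that each is counted exactly once.\<close>

definition linear_orderings :: "('a, 'b) pre_digraph \<Rightarrow> ('a \<Rightarrow> nat) set" where
  "linear_orderings G =
     {\<pi> \<in> verts G \<rightarrow>\<^sub>E {1..card (verts G)}. bij_betw \<pi> (verts G) {1..card (verts G)}}"

definition successive :: "('a, 'b) pre_digraph \<Rightarrow> ('a \<Rightarrow> nat) \<Rightarrow> bool" where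
  "successive G \<pi> \<longleftrightarrow>
     (\<forall>v \<in> verts G. \<pi> v > 1 \<longrightarrow> (\<exists>u \<in> verts G. u \<rightarrow>\<^bsub>G\<^esub> v \<and> \<pi> u < \<pi> v))"

definition num_successive :: "('a, 'b) pre_digraph \<Rightarrow> nat" where
  "num_successive G = card {\<pi> \<in> linear_orderings G. successive G \<pi>}"

definition open_nbhd :: "('a, 'b) pre_digraph \<Rightarrow> 'a set \<Rightarrow> 'a set" where
  "open_nbhd G I = {v \<in> verts G. \<exists>u \<in> I. u \<rightarrow>\<^bsub>G\<^esub> v}"

definition closed_nbhd :: "('a, 'b) pre_digraph \<Rightarrow> 'a set \<Rightarrow> 'a set" where
  "closed_nbhd G I = I \<union> open_nbhd G I"

definition independent_set :: "('a, 'b) pre_digraph \<Rightarrow> 'a set \<Rightarrow> bool" where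
  "independent_set G I \<longleftrightarrow> I \<subseteq> verts G \<and> (\<forall>u \<in> I. \<forall>v \<in> I. \<not> u \<rightarrow>\<^bsub>G\<^esub> v)"

definition coeff_a :: "('a, 'b) pre_digraph \<Rightarrow> 'a set \<Rightarrow> nat" where
  "coeff_a G I = card (verts G - closed_nbhd G I)"

lemma coeff_a_independent:
  assumes "graph G" "independent_set G I"
  shows "int (coeff_a G I) = int (card (verts G)) - int (card I) - int (card (open_nbhd G I))"
proof -
  interpret graph G by fact
  have I: "I \<subseteq> verts G" and disj: "I \<inter> open_nbhd G I = {}"
    using assms(2) by (auto simp: independent_set_def open_nbhd_def)
  have N: "open_nbhd G I \<subseteq> verts G" by (auto simp: open_nbhd_def)
  have fin: "finite I" "finite (open_nbhd G I)"
    using I N finite_verts by (auto intro: finite_subset)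
  have sub: "closed_nbhd G I \<subseteq> verts G" using I N by (auto simp: closed_nbhd_def)
  have "card (closed_nbhd G I) = card I + card (open_nbhd G I)"
    unfolding closed_nbhd_def using fin disj by (rule card_Un_disjoint)
  moreover have "coeff_a G I = card (verts G) - card (closed_nbhd G I)"
    unfolding coeff_a_def using sub finite_verts by (meson card_Diff_subset finite_subset)
  moreover have "card (closed_nbhd G I) \<le> card (verts G)"
    using sub by (simp add: card_mono)
  ultimately show ?thesis by simp
qed

text \<open>
  The recursion only visits subsets of its argument, so dropping the restriction to independent
  sets does not change the values there. Finiteness is needed for termination only.
\<close>

function coeff_b :: "('a, 'b) pre_digraph \<Rightarrow> 'a set \<Rightarrow> real" where
  "coeff_b G I =
     (if I = {} then 1
      else if finite I
      then 1 / (real (card (verts G)) - real (coeff_a G I)) * (\<Sum>v \<in> I. coeff_b G (I - {v}))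
      else 0)"
  by auto
termination
  by (relation "measure (\<lambda>(G, I). card I)") (auto simp: card_gt_0_iff)

declare coeff_b.simps [simp del]

end

theory Submission
  imports Defs "HOL-Combinatorics.Transposition"
begin

text \<open>
  Call a vertex bad for an ordering if it precedes all its neighbours without being first overall;
  an ordering is successive iff it has no bad vertex, so inclusion-exclusion over sets of bad
  vertices applies. Vertices that precede all their neighbours form an independent set \<open>I\<close>.
  The relative order of the members of a set \<open>W\<close> other than \<open>w\<close> is independent of the rank of
  \<open>w\<close> in \<open>W\<close>. With \<open>W = N[I]\<close>, splitting according to the first element of \<open>W\<close>, which must lie in
  \<open>I\<close>, gives the recursion for \<open>b(I)\<close> as the probability that all of \<open>I\<close> precede their
  neighbours. With \<open>W = V\<close>, the first vertex overall lies outside \<open>N[I]\<close> with the further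
  independent probability \<open>a(I)/n\<close>.
\<close>

section \<open>Ranks within a subset\<close>

definition rank :: "'a set \<Rightarrow> ('a \<Rightarrow> nat) \<Rightarrow> 'a \<Rightarrow> nat" where
  "rank W \<pi> y = card {z \<in> W. \<pi> z < \<pi> y}"

lemma rank_mono:
  assumes "finite W" "\<pi> y \<le> \<pi> z"
  shows "rank W \<pi> y \<le> rank W \<pi> z"
  unfolding rank_def using assms by (intro card_mono) auto

lemma rank_less_iff:
  assumes "finite W" "y \<in> W"
  shows "rank W \<pi> y < rank W \<pi> z \<longleftrightarrow> \<pi> y < \<pi> z"
proof
  assume "\<pi> y < \<pi> z"
  then have "{x \<in> W. \<pi> x < \<pi> y} \<subset> {x \<in> W. \<pi> x < \<pi> z}"
    using assms by auto
  then show "rank W \<pi> y < rank W \<pi> z"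
    unfolding rank_def using assms by (intro psubset_card_mono) auto
qed (use rank_mono[OF assms(1), of \<pi> z y] in linarith)

text \<open>Strict monotonicity makes ranks injective. They are below \<open>card W\<close> because
  no element precedes itself, so counting gives surjectivity.\<close>

lemma bij_betw_rank:
  assumes "finite W" "inj_on \<pi> W"
  shows "bij_betw (rank W \<pi>) W {..<card W}"
proof -
  have inj: "inj_on (rank W \<pi>) W"
  proof (rule inj_onI)
    fix y z assume "y \<in> W" "z \<in> W" "rank W \<pi> y = rank W \<pi> z"
    then have "\<pi> y = \<pi> z"
      using rank_less_iff[of W y \<pi> z] rank_less_iff[of W z \<pi> y] assms(1) by auto
    then show "y = z" using assms(2) \<open>y \<in> W\<close> \<open>z \<in> W\<close> by (auto dest: inj_onD)
  qed
  have "rank W \<pi> y < card W" if "y \<in> W" for y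
    unfolding rank_def using that assms by (intro psubset_card_mono) auto
  then have "rank W \<pi> ` W \<subseteq> {..<card W}" by auto
  then have "rank W \<pi> ` W = {..<card W}"
    using inj by (intro card_subset_eq) (auto simp: card_image)
  with inj show ?thesis by (simp add: bij_betw_def)
qed

lemma rank_eq_0_iff:
  assumes "finite W"
  shows "rank W \<pi> w = 0 \<longleftrightarrow> (\<forall>y \<in> W. \<pi> w \<le> \<pi> y)"
  unfolding rank_def using assms by (auto simp: not_less)

lemma rank_comp:
  assumes "bij_betw p W W"
  shows "rank W (\<pi> \<circ> p) y = rank W \<pi> (p y)"
proof -
  have "p ` {z \<in> W. \<pi> (p z) < \<pi> (p y)} = {z \<in> W. \<pi> z < \<pi> (p y)}"
    using assms by (auto simp: bij_betw_def)
  then have "bij_betw p {z \<in> W. \<pi> (p z) < \<pi> (p y)} {z \<in> W. \<pi> z < \<pi> (p y)}"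
    using assms by (intro bij_betw_subset[OF assms]) auto
  then show ?thesis unfolding rank_def by (auto dest: bij_betw_same_card)
qed

text \<open>Exchanging \<open>w\<close> with the element of \<open>W\<close> ranked next to it moves
  \<open>w\<close> by one rank and leaves the relative order of \<open>W - {w}\<close> intact. The
  assumption \<open>closed\<close> says that such exchanges stay in \<open>F\<close>; they give a
  bijection between the two sets.\<close>

lemma card_rank_eq_Suc:
  fixes F :: "('a \<Rightarrow> nat) set"
  assumes "finite W" "w \<in> W"
    and inj: "\<And>\<pi>. \<pi> \<in> F \<Longrightarrow> inj_on \<pi> W"
    and closed: "\<And>\<pi> x. \<pi> \<in> F \<Longrightarrow> x \<in> W \<Longrightarrow>
      (\<And>u v. u \<in> W - {w} \<Longrightarrow> v \<in> W - {w} \<Longrightarrow>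
        (\<pi> \<circ> transpose w x) u < (\<pi> \<circ> transpose w x) v \<longleftrightarrow> \<pi> u < \<pi> v) \<Longrightarrow>
      \<pi> \<circ> transpose w x \<in> F"
    and "Suc k < card W"
  shows "card {\<pi> \<in> F. rank W \<pi> w = Suc k} = card {\<pi> \<in> F. rank W \<pi> w = k}"
proof -
  define T where "T k \<pi> = \<pi> \<circ> transpose w (inv_into W (rank W \<pi>) k)" for k \<pi>
  \<comment> \<open>Treating both directions of adjacency at once yields that
    \<open>T (Suc k)\<close> and \<open>T k\<close> are mutually inverse.\<close>
  have T: "T j \<pi> \<in> F \<and> rank W (T j \<pi>) w = j \<and> T i (T j \<pi>) = \<pi>"
    if adj: "j = Suc i \<or> i = Suc j" and "j < card W" and "\<pi> \<in> F" and i: "rank W \<pi> w = i"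
    for i j \<pi>
  proof -
    have bij: "bij_betw (rank W \<pi>) W {..<card W}"
      using assms(1) inj[OF \<open>\<pi> \<in> F\<close>] by (rule bij_betw_rank)
    define x where "x = inv_into W (rank W \<pi>) j"
    have x: "x \<in> W" "rank W \<pi> x = j"
      using bij \<open>j < card W\<close> unfolding x_def bij_betw_def
      by (auto intro: inv_into_into f_inv_into_f)
    then have "x \<noteq> w" using i adj by auto
    let ?\<pi>' = "\<pi> \<circ> transpose w x"
    have T_eq: "T j \<pi> = ?\<pi>'" by (simp add: T_def x_def)
    have bt: "bij_betw (transpose w x) W W" using x \<open>w \<in> W\<close> by simp
    \<comment> \<open>No third element of \<open>W\<close> lies between \<open>w\<close> and
      \<open>x\<close>, since their ranks are consecutive; so \<open>v\<close> compares alike with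
      both.\<close>
    have other: "\<pi> x < \<pi> v \<longleftrightarrow> \<pi> w < \<pi> v" "\<pi> v < \<pi> x \<longleftrightarrow> \<pi> v < \<pi> w"
      if "v \<in> W" "v \<noteq> w" "v \<noteq> x" for v
    proof -
      have "rank W \<pi> v \<noteq> i" "rank W \<pi> v \<noteq> j"
        using bij that x i \<open>w \<in> W\<close> by (auto simp: bij_betw_def dest: inj_onD)
      then have "j < rank W \<pi> v \<longleftrightarrow> i < rank W \<pi> v" "rank W \<pi> v < j \<longleftrightarrow> rank W \<pi> v < i"
        using adj by auto
      then show "\<pi> x < \<pi> v \<longleftrightarrow> \<pi> w < \<pi> v" "\<pi> v < \<pi> x \<longleftrightarrow> \<pi> v < \<pi> w"
        using rank_less_iff[OF assms(1), of _ \<pi>] x i that \<open>w \<in> W\<close> by metis+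
    qed
    have "?\<pi>' \<in> F"
    proof (rule closed[OF \<open>\<pi> \<in> F\<close> x(1)])
      fix u v assume "u \<in> W - {w}" "v \<in> W - {w}"
      then show "?\<pi>' u < ?\<pi>' v \<longleftrightarrow> \<pi> u < \<pi> v"
        using other by (cases "u = x"; cases "v = x") auto
    qed
    moreover have "rank W ?\<pi>' w = j" by (simp only: rank_comp[OF bt] transpose_apply_first x)
    moreover have "T i ?\<pi>' = \<pi>"
    proof -
      have "rank W ?\<pi>' x = i" by (simp only: rank_comp[OF bt] transpose_apply_second i)
      moreover have "inj_on (rank W ?\<pi>') W"
        using bij_betw_rank[OF assms(1) inj[OF \<open>?\<pi>' \<in> F\<close>]] by (simp add: bij_betw_def)
      \<comment> \<open>After the exchange \<open>x\<close> holds the old rank of \<open>w\<close>,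
        so \<open>T i\<close> selects \<open>x\<close> again and applies the same
        involution.\<close>
      ultimately have "inv_into W (rank W ?\<pi>') i = x" using x(1) by (metis inv_into_f_f)
      then show ?thesis by (simp add: T_def comp_assoc)
    qed
    ultimately show ?thesis by (simp add: T_eq)
  qed
  have "bij_betw (T (Suc k)) {\<pi> \<in> F. rank W \<pi> w = k} {\<pi> \<in> F. rank W \<pi> w = Suc k}"
    by (rule bij_betw_byWitness[where f' = "T k"])
      (use T[of "Suc k" k] T[of k "Suc k"] \<open>Suc k < card W\<close> in auto)
  then show ?thesis by (simp add: bij_betw_same_card)
qed

text \<open>By \<open>card_rank_eq_Suc\<close> all \<open>card W\<close> possible ranks of
  \<open>w\<close> occur equally often in \<open>F\<close>; being first in \<open>W\<close> is rank
  0.\<close>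

lemma card_first_in:
  fixes F :: "('a \<Rightarrow> nat) set"
  assumes "finite F" "finite W" "w \<in> W"
    and inj: "\<And>\<pi>. \<pi> \<in> F \<Longrightarrow> inj_on \<pi> W"
    and closed: "\<And>\<pi> x. \<pi> \<in> F \<Longrightarrow> x \<in> W \<Longrightarrow>
      (\<And>u v. u \<in> W - {w} \<Longrightarrow> v \<in> W - {w} \<Longrightarrow>
        (\<pi> \<circ> transpose w x) u < (\<pi> \<circ> transpose w x) v \<longleftrightarrow> \<pi> u < \<pi> v) \<Longrightarrow>
      \<pi> \<circ> transpose w x \<in> F"
  shows "card W * card {\<pi> \<in> F. \<forall>y \<in> W. \<pi> w \<le> \<pi> y} = card F"
proof -
  let ?A = "\<lambda>k. {\<pi> \<in> F. rank W \<pi> w = k}"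
  have const: "card (?A k) = card (?A 0)" if "k < card W" for k
    using that
  proof (induction k)
    case (Suc k)
    then show ?case using card_rank_eq_Suc[OF assms(2-5), of k] by simp
  qed simp
  have "rank W \<pi> w < card W" if "\<pi> \<in> F" for \<pi>
    using bij_betw_rank[OF assms(2) inj[OF that]] assms(3) by (auto simp: bij_betw_def)
  then have "F = (\<Union>k<card W. ?A k)" by auto
  then have "card F = card (\<Union>k<card W. ?A k)" by simp
  also have "\<dots> = (\<Sum>k<card W. card (?A k))"
    using assms(1) by (intro card_UN_disjoint) auto
  also have "\<dots> = (\<Sum>k<card W. card (?A 0))" by (rule sum.cong[OF refl const]) simp
  also have "\<dots> = card W * card (?A 0)" by simp
  finally show ?thesis by (simp add: rank_eq_0_iff[OF assms(2)])
qed

section \<open>Orderings in which given vertices precede their neighbours\<close>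

text \<open>The sum is the expansion of the product of \<open>(- 1) + 1\<close> over
  \<open>A\<close>. It serves as the indicator of having no bad vertex.\<close>

lemma sum_Pow_minus_one_power_card:
  assumes "finite A"
  shows "(\<Sum>X \<in> Pow A. (- 1) ^ card X) = (if A = {} then 1 else 0 :: real)"
  using prod_add[OF assms, of "\<lambda>_. - 1 :: real" "\<lambda>_. 1"] assms
  by (cases "A = {}") (simp_all add: power_0_left)

text \<open>Members of \<open>I\<close> may still be first overall. Excluding that is left to a
  separate count, so that these sets satisfy the recursion of \<open>coeff_b\<close>.\<close>

definition local_min_orderings :: "('a, 'b) pre_digraph \<Rightarrow> 'a set \<Rightarrow> ('a \<Rightarrow> nat) set" where
  "local_min_orderings G I =
     {\<pi> \<in> linear_orderings G. \<forall>v \<in> I. \<forall>u. v \<rightarrow>\<^bsub>G\<^esub> u \<longrightarrow> \<pi> v < \<pi> u}"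

context graph
begin

section \<open>Linear orderings: their number and their behaviour under transpositions\<close>

lemma finite_linear_orderings: "finite (linear_orderings G)"
  unfolding linear_orderings_def
  by (rule finite_subset[of _ "verts G \<rightarrow>\<^sub>E {1..card (verts G)}"]) (auto intro: finite_PiE)

lemma finite_local_min_orderings: "finite (local_min_orderings G I)"
  unfolding local_min_orderings_def using finite_linear_orderings by simp

lemma card_linear_orderings: "card (linear_orderings G) = fact (card (verts G))"
proof -
  let ?n = "card (verts G)"
  have "bij_betw \<pi> (verts G) {1..?n} \<longleftrightarrow> inj_on \<pi> (verts G)" if "\<pi> \<in> verts G \<rightarrow>\<^sub>E {1..?n}" for \<pi>
  proof -
    have "\<pi> ` verts G \<subseteq> {1..?n}" using that by auto
    then show ?thesis
      unfolding bij_betw_def by (auto simp: card_image dest: card_subset_eq[rotated])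
  qed
  then have "linear_orderings G = {\<pi> \<in> verts G \<rightarrow>\<^sub>E {1..?n}. inj_on \<pi> (verts G)}"
    unfolding linear_orderings_def by blast
  then show ?thesis
    using card_inj_on_subset_funcset[of "verts G" "{1..?n}" "verts G"]
    by (simp add: fact_prod_rev)
qed

lemma linear_orderings_inj_on: "\<pi> \<in> linear_orderings G \<Longrightarrow> inj_on \<pi> (verts G)"
  by (simp add: linear_orderings_def bij_betw_def)

lemma linear_orderings_comp_transpose:
  assumes "\<pi> \<in> linear_orderings G" "w \<in> verts G" "x \<in> verts G"
  shows "\<pi> \<circ> transpose w x \<in> linear_orderings G"
proof -
  have bij: "bij_betw \<pi> (verts G) {1..card (verts G)}" and ext: "\<pi> \<in> extensional (verts G)"
    using assms by (auto simp: linear_orderings_def PiE_def)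
  have "bij_betw (\<pi> \<circ> transpose w x) (verts G) {1..card (verts G)}"
    using assms by (intro bij_betw_trans[OF _ bij]) simp
  \<comment> \<open>Both \<open>w\<close> and \<open>x\<close> are vertices, so the transposition
    fixes every point outside \<open>verts G\<close>.\<close>
  moreover have "\<pi> \<circ> transpose w x \<in> extensional (verts G)"
    using ext assms(2,3) by (auto simp: extensional_def transpose_def)
  ultimately show ?thesis
    by (auto simp: linear_orderings_def PiE_def dest: bij_betw_apply)
qed

lemma linear_orderings_first_iff:
  assumes "\<pi> \<in> linear_orderings G" "w \<in> verts G"
  shows "\<pi> w = 1 \<longleftrightarrow> (\<forall>y \<in> verts G. \<pi> w \<le> \<pi> y)"
proof -
  have img: "\<pi> ` verts G = {1..card (verts G)}"
    using assms by (simp add: linear_orderings_def bij_betw_def)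
  have "0 < card (verts G)" using assms(2) by (auto simp: card_gt_0_iff)
  then have "1 \<in> \<pi> ` verts G" unfolding img by simp
  moreover have "\<forall>y \<in> verts G. 1 \<le> \<pi> y" using img by force
  ultimately show ?thesis using assms(2) by (metis imageE le_antisym)
qed

section \<open>Closed neighbourhoods and counting by the first vertex\<close>

lemma closed_nbhd_subset: "I \<subseteq> verts G \<Longrightarrow> closed_nbhd G I \<subseteq> verts G"
  by (auto simp: closed_nbhd_def open_nbhd_def)

text \<open>The condition defining \<open>local_min_orderings G J\<close> compares only vertices of
  \<open>closed_nbhd G J\<close>, hence only elements of \<open>W - {w}\<close>. This is the closure
  condition of \<open>card_first_in\<close>.\<close>

lemma card_local_min_orderings_first:
  assumes W: "W \<subseteq> verts G" "w \<in> W" and J: "closed_nbhd G J \<subseteq> W - {w}"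
  shows "card W * card {\<pi> \<in> local_min_orderings G J. \<forall>y \<in> W. \<pi> w \<le> \<pi> y} =
    card (local_min_orderings G J)"
proof (rule card_first_in)
  show "finite W" using W by (auto intro: finite_subset)
next
  fix \<pi> assume "\<pi> \<in> local_min_orderings G J"
  then show "inj_on \<pi> W"
    using W linear_orderings_inj_on by (auto simp: local_min_orderings_def intro: inj_on_subset)
next
  fix \<pi> x assume \<pi>: "\<pi> \<in> local_min_orderings G J" and "x \<in> W"
    and *: "\<And>u v. u \<in> W - {w} \<Longrightarrow> v \<in> W - {w} \<Longrightarrow>
        (\<pi> \<circ> transpose w x) u < (\<pi> \<circ> transpose w x) v \<longleftrightarrow> \<pi> u < \<pi> v"
  have "\<pi> \<circ> transpose w x \<in> linear_orderings G"
    using \<pi> W \<open>x \<in> W\<close> by (intro linear_orderings_comp_transpose) (auto simp: local_min_orderings_def)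
  moreover have "(\<pi> \<circ> transpose w x) v < (\<pi> \<circ> transpose w x) u" if "v \<in> J" "v \<rightarrow>\<^bsub>G\<^esub> u" for u v
  proof -
    have "u \<in> verts G" using that by auto
    then have "v \<in> W - {w}" "u \<in> W - {w}"
      using J that by (auto simp: closed_nbhd_def open_nbhd_def)
    then show ?thesis using * \<pi> that by (auto simp: local_min_orderings_def)
  qed
  ultimately show "\<pi> \<circ> transpose w x \<in> local_min_orderings G J"
    by (simp add: local_min_orderings_def)
qed (use W finite_local_min_orderings in auto)

text \<open>Identifies the denominator in the recursion of \<open>coeff_b\<close> as the size of the
  set in which a member of \<open>I\<close> comes first.\<close>

lemma card_verts_minus_coeff_a:
  assumes "I \<subseteq> verts G"
  shows "real (card (verts G)) - real (coeff_a G I) = real (card (closed_nbhd G I))"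
proof -
  have sub: "closed_nbhd G I \<subseteq> verts G" using assms by (rule closed_nbhd_subset)
  then have "finite (closed_nbhd G I)" by (auto intro: finite_subset)
  then show ?thesis
    using sub card_mono[OF finite_verts sub]
    by (simp add: coeff_a_def card_Diff_subset)
qed

text \<open>An injective ordering has only one minimum on \<open>W\<close>, so the sets for
  different \<open>v\<close> are disjoint.\<close>

lemma card_UN_first_in:
  assumes "W \<subseteq> verts G" "S \<subseteq> W" and F: "\<And>v. v \<in> S \<Longrightarrow> F v \<subseteq> linear_orderings G"
  shows "card (\<Union>v \<in> S. {\<pi> \<in> F v. \<forall>y \<in> W. \<pi> v \<le> \<pi> y}) =
    (\<Sum>v \<in> S. card {\<pi> \<in> F v. \<forall>y \<in> W. \<pi> v \<le> \<pi> y})"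
proof (rule card_UN_disjoint)
  show "finite S" using assms by (meson finite_subset finite_verts)
  show "\<forall>v\<in>S. finite {\<pi> \<in> F v. \<forall>y \<in> W. \<pi> v \<le> \<pi> y}"
    using F finite_linear_orderings by (simp add: finite_subset[OF F])
  have "False" if "u \<in> S" "v \<in> S" "u \<noteq> v" "\<pi> \<in> F u" "\<forall>y \<in> W. \<pi> u \<le> \<pi> y" "\<forall>y \<in> W. \<pi> v \<le> \<pi> y"
    for u v \<pi>
  proof -
    have "\<pi> u = \<pi> v" using that assms by (meson le_antisym subsetD)
    moreover have "inj_on \<pi> (verts G)" using F that linear_orderings_inj_on by blast
    ultimately show False using that assms by (meson inj_onD subsetD)
  qed
  then show "\<forall>u\<in>S. \<forall>v\<in>S. u \<noteq> v \<longrightarrow>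
      {\<pi> \<in> F u. \<forall>y \<in> W. \<pi> u \<le> \<pi> y} \<inter> {\<pi> \<in> F v. \<forall>y \<in> W. \<pi> v \<le> \<pi> y} = {}"
    by blast
qed

text \<open>A vertex of \<open>open_nbhd G I\<close> is preceded by a neighbour in \<open>I\<close>,
  so the first vertex \<open>v\<close> of \<open>closed_nbhd G I\<close> lies in \<open>I\<close>.
  Conversely, such a \<open>v\<close> precedes its own neighbours, and \<open>I - {v}\<close>
  accounts for the others.\<close>

lemma local_min_orderings_split:
  assumes I: "independent_set G I" "I \<noteq> {}"
  shows "local_min_orderings G I =
    (\<Union>v \<in> I. {\<pi> \<in> local_min_orderings G (I - {v}). \<forall>y \<in> closed_nbhd G I. \<pi> v \<le> \<pi> y})"
    (is "_ = ?R")
proof (intro equalityI subsetI)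
  fix \<pi> assume \<pi>: "\<pi> \<in> local_min_orderings G I"
  have "closed_nbhd G I \<noteq> {}" "finite (closed_nbhd G I)"
    using I closed_nbhd_subset[of I]
    by (auto simp: closed_nbhd_def independent_set_def intro: finite_subset)
  then obtain v where v: "v \<in> closed_nbhd G I" "\<forall>y \<in> closed_nbhd G I. \<pi> v \<le> \<pi> y"
    using arg_min_if_finite[of "closed_nbhd G I" \<pi>] by (metis not_less)
  have "v \<in> I"
  proof (rule ccontr)
    assume "v \<notin> I"
    then obtain u where "u \<in> I" "u \<rightarrow>\<^bsub>G\<^esub> v"
      using v by (auto simp: closed_nbhd_def open_nbhd_def)
    then have "\<pi> u < \<pi> v" "u \<in> closed_nbhd G I"
      using \<pi> by (auto simp: local_min_orderings_def closed_nbhd_def)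
    then show False using v by (meson not_less)
  qed
  then show "\<pi> \<in> ?R" using \<pi> v by (auto simp: local_min_orderings_def)
next
  fix \<pi> assume "\<pi> \<in> ?R"
  then obtain v where v: "v \<in> I" "\<pi> \<in> local_min_orderings G (I - {v})"
    "\<forall>y \<in> closed_nbhd G I. \<pi> v \<le> \<pi> y" by blast
  have L: "\<pi> \<in> linear_orderings G" using v by (simp add: local_min_orderings_def)
  have "\<pi> v < \<pi> u" if "v \<rightarrow>\<^bsub>G\<^esub> u" for u
  proof -
    have uv: "u \<in> verts G" "v \<in> verts G" "u \<noteq> v" using that adj_not_same by auto
    then have "\<pi> v \<le> \<pi> u" using v that by (auto simp: closed_nbhd_def open_nbhd_def)
    moreover have "\<pi> v \<noteq> \<pi> u" using uv linear_orderings_inj_on[OF L] by (auto dest: inj_onD)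
    ultimately show ?thesis by simp
  qed
  then show "\<pi> \<in> local_min_orderings G I" using v by (auto simp: local_min_orderings_def)
qed

text \<open>Induction on \<open>card I\<close>: each \<open>v\<close> in \<open>I\<close> is first
  in \<open>closed_nbhd G I\<close> for a fraction \<open>1 / card (closed_nbhd G I)\<close> of the
  orderings counted for \<open>I - {v}\<close>, which is the recursion of
  \<open>coeff_b\<close>.\<close>

lemma card_local_min_orderings:
  assumes "independent_set G I"
  shows "real (card (local_min_orderings G I)) = fact (card (verts G)) * coeff_b G I"
  using assms
proof (induction "card I" arbitrary: I rule: less_induct)
  case less
  have sub: "I \<subseteq> verts G" using less.prems by (simp add: independent_set_def)
  then have fin: "finite I" by (auto intro: finite_subset)
  show ?case
  proof (cases "I = {}")
    case True
    then show ?thesis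
      by (simp add: coeff_b.simps local_min_orderings_def card_linear_orderings)
  next
    case False
    let ?W = "closed_nbhd G I"
    let ?S = "\<lambda>v. {\<pi> \<in> local_min_orderings G (I - {v}). \<forall>y \<in> ?W. \<pi> v \<le> \<pi> y}"
    have W: "?W \<subseteq> verts G" "I \<subseteq> ?W"
      using closed_nbhd_subset[OF sub] by (auto simp: closed_nbhd_def)
    have Wpos: "real (card ?W) > 0"
      using W False by (auto simp: card_gt_0_iff intro: finite_subset)
    have S: "real (card (?S v)) = fact (card (verts G)) * coeff_b G (I - {v}) / real (card ?W)"
      if "v \<in> I" for v
    proof -
      \<comment> \<open>Independence enters here: \<open>v\<close> is not adjacent to any other
        member of \<open>I\<close>.\<close>
      have "closed_nbhd G (I - {v}) \<subseteq> ?W - {v}"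
        using less.prems that by (auto simp: closed_nbhd_def open_nbhd_def independent_set_def)
      then have "card ?W * card (?S v) = card (local_min_orderings G (I - {v}))"
        using W that by (intro card_local_min_orderings_first) auto
      moreover have "real (card (local_min_orderings G (I - {v}))) =
          fact (card (verts G)) * coeff_b G (I - {v})"
        using less.prems
        by (intro less.hyps card_Diff1_less fin that) (auto simp: independent_set_def)
      ultimately show ?thesis using Wpos by (simp add: field_simps flip: of_nat_mult)
    qed
    have "card (local_min_orderings G I) = (\<Sum>v \<in> I. card (?S v))"
      unfolding local_min_orderings_split[OF less.prems False]
      using W by (intro card_UN_first_in) (auto simp: local_min_orderings_def)
    then have "real (card (local_min_orderings G I)) =
        (\<Sum>v \<in> I. fact (card (verts G)) * coeff_b G (I - {v}) / real (card ?W))"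
      using S by simp
    also have "\<dots> = fact (card (verts G)) * coeff_b G I"
      using False fin
      by (subst (2) coeff_b.simps)
        (simp add: card_verts_minus_coeff_a[OF sub] sum_distrib_left sum_divide_distrib)
    finally show ?thesis .
  qed
qed

text \<open>When no member of \<open>I\<close> is first overall, the first vertex is not in
  \<open>open_nbhd G I\<close> either, so it is one of \<open>coeff_a G I\<close> vertices. Each of
  these is first in one out of \<open>card (verts G)\<close> of the orderings.\<close>

lemma card_local_min_orderings_not_first:
  assumes I: "independent_set G I"
  shows "card (verts G) * card {\<pi> \<in> local_min_orderings G I. \<forall>v \<in> I. \<pi> v \<noteq> 1} =
    coeff_a G I * card (local_min_orderings G I)"
proof (cases "verts G = {}")
  case True
  then show ?thesis by (simp add: coeff_a_def)
next
  case False
  let ?S = "\<lambda>w. {\<pi> \<in> local_min_orderings G I. \<forall>y \<in> verts G. \<pi> w \<le> \<pi> y}"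
  have sub: "I \<subseteq> verts G" using I by (simp add: independent_set_def)
  have "{\<pi> \<in> local_min_orderings G I. \<forall>v \<in> I. \<pi> v \<noteq> 1} =
      (\<Union>w \<in> verts G - closed_nbhd G I. ?S w)" (is "?L = ?R")
  proof (intro equalityI subsetI)
    fix \<pi> assume \<pi>: "\<pi> \<in> ?L"
    then have L: "\<pi> \<in> linear_orderings G" by (simp add: local_min_orderings_def)
    obtain w where w: "w \<in> verts G" "\<forall>y \<in> verts G. \<pi> w \<le> \<pi> y"
      using False arg_min_if_finite[of "verts G" \<pi>] by (metis finite_verts not_less)
    then have "\<pi> w = 1" using linear_orderings_first_iff[OF L] by blast
    then have "w \<notin> I" using \<pi> by auto
    moreover have "\<not> u \<rightarrow>\<^bsub>G\<^esub> w" if "u \<in> I" for u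
    proof
      assume "u \<rightarrow>\<^bsub>G\<^esub> w"
      then have "\<pi> u < \<pi> w" using \<pi> that by (auto simp: local_min_orderings_def)
      then show False using w sub that by (meson not_less subsetD)
    qed
    ultimately have "w \<notin> closed_nbhd G I" by (auto simp: closed_nbhd_def open_nbhd_def)
    then show "\<pi> \<in> ?R" using \<pi> w by blast
  next
    fix \<pi> assume "\<pi> \<in> ?R"
    then obtain w where w: "w \<in> verts G" "w \<notin> closed_nbhd G I" "\<pi> \<in> ?S w" by blast
    then have L: "\<pi> \<in> linear_orderings G" by (simp add: local_min_orderings_def)
    have "\<pi> w = 1" using w linear_orderings_first_iff[OF L] by blast
    then have "\<pi> v \<noteq> 1" if "v \<in> I" for v
      using that w sub linear_orderings_inj_on[OF L]
      by (metis UnI1 closed_nbhd_def inj_onD subsetD)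
    then show "\<pi> \<in> ?L" using w by blast
  qed
  then have "card ?L = (\<Sum>w \<in> verts G - closed_nbhd G I. card (?S w))"
    using card_UN_first_in[of "verts G" "verts G - closed_nbhd G I" "\<lambda>_. local_min_orderings G I"]
    by (simp add: local_min_orderings_def)
  then have "card (verts G) * card ?L =
      (\<Sum>w \<in> verts G - closed_nbhd G I. card (verts G) * card (?S w))"
    by (simp add: sum_distrib_left)
  also have "\<dots> = (\<Sum>w \<in> verts G - closed_nbhd G I. card (local_min_orderings G I))"
    using closed_nbhd_subset[OF sub]
    by (intro sum.cong refl card_local_min_orderings_first) auto
  finally show ?thesis by (simp add: coeff_a_def)
qed

section \<open>Inclusion-exclusion over bad vertices\<close>

definition bad_verts :: "('a \<Rightarrow> nat) \<Rightarrow> 'a set" where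
  "bad_verts \<pi> = {v \<in> verts G. \<pi> v \<noteq> 1 \<and> (\<forall>u. v \<rightarrow>\<^bsub>G\<^esub> u \<longrightarrow> \<pi> v < \<pi> u)}"

lemma finite_bad_verts: "finite (bad_verts \<pi>)"
  by (simp add: bad_verts_def)

text \<open>Injectivity and the absence of loops turn "no neighbour is earlier" into "all neighbours
  are later". Symmetry of adjacency reconciles the arc directions in the two definitions.\<close>

lemma successive_iff_bad_verts:
  assumes "\<pi> \<in> linear_orderings G"
  shows "successive G \<pi> \<longleftrightarrow> bad_verts \<pi> = {}"
proof -
  have "(\<exists>u \<in> verts G. u \<rightarrow>\<^bsub>G\<^esub> v \<and> \<pi> u < \<pi> v) \<longleftrightarrow> \<not> (\<forall>u. v \<rightarrow>\<^bsub>G\<^esub> u \<longrightarrow> \<pi> v < \<pi> u)" for v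
  proof -
    have "\<pi> u < \<pi> v \<longleftrightarrow> \<not> \<pi> v < \<pi> u" if "v \<rightarrow>\<^bsub>G\<^esub> u" for u
    proof -
      have "u \<in> verts G" "v \<in> verts G" "u \<noteq> v" using that adj_not_same by auto
      then have "\<pi> u \<noteq> \<pi> v" using linear_orderings_inj_on[OF assms] by (auto dest: inj_onD)
      then show ?thesis by auto
    qed
    moreover have "u \<in> verts G \<and> u \<rightarrow>\<^bsub>G\<^esub> v \<longleftrightarrow> v \<rightarrow>\<^bsub>G\<^esub> u" for u
      using graph_symmetric[of u v] graph_symmetric[of v u] adj_in_verts(2)[of v u] by blast
    ultimately show ?thesis by blast
  qed
  moreover have "\<pi> v > 1 \<longleftrightarrow> \<pi> v \<noteq> 1" if "v \<in> verts G" for v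
    using assms that by (force simp: linear_orderings_def dest: PiE_mem)
  ultimately show ?thesis unfolding successive_def bad_verts_def by auto
qed

lemma subset_bad_verts_iff:
  assumes "\<pi> \<in> linear_orderings G" "I \<subseteq> verts G"
  shows "I \<subseteq> bad_verts \<pi> \<longleftrightarrow> \<pi> \<in> local_min_orderings G I \<and> (\<forall>v \<in> I. \<pi> v \<noteq> 1)"
  using assms by (auto simp: bad_verts_def local_min_orderings_def)

text \<open>Two adjacent vertices cannot each precede the other. This confines inclusion-exclusion
  to independent sets.\<close>

lemma independent_set_bad_verts:
  assumes "I \<subseteq> bad_verts \<pi>"
  shows "independent_set G I"
proof -
  have "\<not> u \<rightarrow>\<^bsub>G\<^esub> v" if "u \<in> I" "v \<in> I" for u v
  proof
    assume "u \<rightarrow>\<^bsub>G\<^esub> v"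
    moreover from this have "v \<rightarrow>\<^bsub>G\<^esub> u" by (rule graph_symmetric)
    ultimately have "\<pi> u < \<pi> v" "\<pi> v < \<pi> u"
      using that assms by (auto simp: bad_verts_def)
    then show False by simp
  qed
  then show ?thesis using assms by (auto simp: independent_set_def bad_verts_def)
qed

lemma num_successive_eq_sum:
  "real (num_successive G) =
    (\<Sum>I \<in> {I. I \<subseteq> verts G \<and> independent_set G I}.
      (-1) ^ card I * real (card {\<pi> \<in> local_min_orderings G I. \<forall>v \<in> I. \<pi> v \<noteq> 1}))"
proof -
  let ?L = "linear_orderings G" and ?Ind = "{I. I \<subseteq> verts G \<and> independent_set G I}"
  have Pow_bad: "Pow (bad_verts \<pi>) = {I \<in> ?Ind. I \<subseteq> bad_verts \<pi>}" for \<pi>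
    using independent_set_bad_verts by (auto simp: bad_verts_def)
  have finInd: "finite ?Ind" by simp
  have "real (num_successive G) = (\<Sum>\<pi> \<in> ?L. if bad_verts \<pi> = {} then 1 else 0)"
    using finite_linear_orderings successive_iff_bad_verts
    by (simp add: num_successive_def sum.If_cases Int_def conj_commute cong: conj_cong)
  also have "\<dots> = (\<Sum>\<pi> \<in> ?L. \<Sum>I \<in> {I \<in> ?Ind. I \<subseteq> bad_verts \<pi>}. (-1) ^ card I)"
    by (simp only: sum_Pow_minus_one_power_card[OF finite_bad_verts, symmetric] Pow_bad)
  \<comment> \<open>Exchanging the sums counts, for each fixed \<open>I\<close>, the orderings in
    which all of \<open>I\<close> is bad.\<close>
  also have "\<dots> = (\<Sum>I \<in> ?Ind. \<Sum>\<pi> \<in> {\<pi> \<in> ?L. I \<subseteq> bad_verts \<pi>}. (-1) ^ card I)"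
    by (rule sum.swap_restrict[OF finite_linear_orderings finInd])
  also have "\<dots> = (\<Sum>I \<in> ?Ind.
      (-1) ^ card I * real (card {\<pi> \<in> local_min_orderings G I. \<forall>v \<in> I. \<pi> v \<noteq> 1}))"
  proof (rule sum.cong[OF refl])
    fix I assume "I \<in> ?Ind"
    then have "{\<pi> \<in> ?L. I \<subseteq> bad_verts \<pi>} =
        {\<pi> \<in> local_min_orderings G I. \<forall>v \<in> I. \<pi> v \<noteq> 1}"
      using subset_bad_verts_iff[of _ I] unfolding local_min_orderings_def by blast
    then show "(\<Sum>\<pi> \<in> {\<pi> \<in> ?L. I \<subseteq> bad_verts \<pi>}. (-1) ^ card I) =
        (-1) ^ card I * real (card {\<pi> \<in> local_min_orderings G I. \<forall>v \<in> I. \<pi> v \<noteq> 1})"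
      by simp
  qed
  finally show ?thesis .
qed

end

theorem theorem1p2:
  fixes G :: "('a, 'b) pre_digraph" and n :: nat
  assumes "graph G"
    and "Digraph_Component.connected G"
    and "card (verts G) = n"
  shows "real (num_successive G) =
    fact n * (\<Sum>I \<in> {I. I \<subseteq> verts G \<and> independent_set G I}.
      (-1) ^ card I * (real (coeff_a G I) / real n) * coeff_b G I)"
proof -
  interpret graph G by fact
  \<comment> \<open>Connectedness includes nonemptiness in its definition, which makes
    \<open>n\<close> positive and the division by \<open>n\<close> genuine.\<close>
  have "verts G \<noteq> {}"
    using assms(2) by (auto simp: connected_def strongly_connected_def)
  then have n: "0 < n" using assms(3) by (auto simp: card_gt_0_iff)
  have "real (card {\<pi> \<in> local_min_orderings G I. \<forall>v \<in> I. \<pi> v \<noteq> 1}) =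
      real (coeff_a G I) / real n * (fact n * coeff_b G I)" if "independent_set G I" for I
    using arg_cong[OF card_local_min_orderings_not_first[OF that], of real]
      card_local_min_orderings[OF that] assms(3) n
    by (simp add: field_simps)
  then show ?thesis
    unfolding num_successive_eq_sum sum_distrib_left by (intro sum.cong) auto
qed

end
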